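(* Let $n,t,\delta$ be integers with $n\ge 3$ and $4\le 2t\le \delta\le \left\lfloor \frac{n+t-1}{2}\right\rfloor$, let $\alpha\in[0,1)$, and let $h=\left\lfloor \frac{n+t-1}{2}\right\rfloor$. Put $$f_0(n,t,\delta,2)=\binom{n+t-\delta}{2}+(\delta-t)\delta,\qquad g_0(n,t,\delta,2)=\binom{n+t-h}{2}+(h-t-1)h+\delta,$$ and $h_0=\max\{f_0(n,t,\delta,2),\,g_0(n,t,\delta,2)\}$. Let $G$ be a finite, simple, connected graph of order $n$ with minimum degree $\delta$. If $$\lambda_\alpha(G)>\frac{\delta+\alpha n-\alpha\delta-1+\sqrt{(\delta+\alpha n-\alpha\delta-1)^2+4(1-\alpha)(2h_0-n\delta+\delta)}}{2},$$ then $G$ is many-to-many $t$-disjoint path coverable.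
   Context: The order of a graph is its number of vertices. For $\alpha\in[0,1)$, $A_\alpha(G)=\alpha D(G)+(1-\alpha)A(G)$, where $A(G)$ is the adjacency matrix and $D(G)$ the diagonal matrix of vertex degrees of $G$; the $\alpha$-spectral radius $\lambda_\alpha(G)$ is the largest eigenvalue of $A_\alpha(G)$. A graph $G$ is many-to-many $t$-disjoint path coverable if for any two disjoint vertex subsets $U=\{u_1,\dots,u_t\}$ and $V=\{v_1,\dots,v_t\}$ of $G$, each consisting of $t$ distinct vertices, there exist a permutation $\tau$ of $\{1,\dots,t\}$ and $t$ paths $P_1,\dots,P_t$ in $G$ such that $P_i$ joins $u_i$ and $v_{\tau(i)}$ and every vertex of $G$ belongs to exactly one of the paths. *)

theory Defs
  imports
    Complex_Main
    "HOL-Combinatorics.Permutations"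
    "Graph_Theory.Graph_Theory"
    "Jordan_Normal_Form.Spectral_Radius"
begin

text \<open>
  A finite simple graph is a \<^locale>\<open>pair_graph\<close>: an edge is a pair of opposite arcs, so the degree
  of a vertex is its \<^const>\<open>out_degree\<close>.
\<close>

definition min_degree :: "'a pair_pre_digraph \<Rightarrow> nat" where
  "min_degree G = Min (out_degree G ` pverts G)"

text \<open>
  A matrix of a graph is written with respect to an ordering of the vertices, i.e. a duplicate-free
  list of all of them.
\<close>

definition vertex_orderings :: "'a pair_pre_digraph \<Rightarrow> 'a list set" where
  "vertex_orderings G = {vs. distinct vs \<and> set vs = pverts G}"

definition adjacency_matrix :: "'a pair_pre_digraph \<Rightarrow> 'a list \<Rightarrow> real mat" where
  "adjacency_matrix G vs =
     mat (length vs) (length vs) (\<lambda>(i, j). if (vs ! i, vs ! j) \<in> parcs G then 1 else 0)"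

definition degree_matrix :: "'a pair_pre_digraph \<Rightarrow> 'a list \<Rightarrow> real mat" where
  "degree_matrix G vs = mat_diag (length vs) (\<lambda>i. real (out_degree G (vs ! i)))"

definition A_alpha :: "real \<Rightarrow> 'a pair_pre_digraph \<Rightarrow> 'a list \<Rightarrow> real mat" where
  "A_alpha \<alpha> G vs = \<alpha> \<cdot>\<^sub>m degree_matrix G vs + (1 - \<alpha>) \<cdot>\<^sub>m adjacency_matrix G vs"

text \<open>
  All vertex orderings give the same eigenvalues (lemma \<open>spectrum_A_alpha_ordering\<close> below), so the
  union ranges over copies of one set. For real matrices \<^const>\<open>spectrum\<close> is the set of real
  eigenvalues, which are all eigenvalues here since the matrix is symmetric.
\<close>

definition alpha_spectral_radius :: "real \<Rightarrow> 'a pair_pre_digraph \<Rightarrow> real" where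
  "alpha_spectral_radius \<alpha> G = Max (\<Union>vs \<in> vertex_orderings G. spectrum (A_alpha \<alpha> G vs))"

text \<open>
  A path is a nonempty duplicate-free list of vertices, consecutive ones being adjacent
  (\<^const>\<open>vpath\<close>).
\<close>

definition many_to_many_disjoint_path_coverable :: "nat \<Rightarrow> 'a pair_pre_digraph \<Rightarrow> bool" where
  "many_to_many_disjoint_path_coverable t G \<longleftrightarrow>
     (\<forall>u v :: nat \<Rightarrow> 'a.
        inj_on u {1..t} \<and> inj_on v {1..t} \<and>
        u ` {1..t} \<subseteq> pverts G \<and> v ` {1..t} \<subseteq> pverts G \<and>
        u ` {1..t} \<inter> v ` {1..t} = {} \<longrightarrow>
        (\<exists>\<tau> P. \<tau> permutes {1..t} \<and>
           (\<forall>i \<in> {1..t}. vpath (P i) G \<and> hd (P i) = u i \<and> last (P i) = v (\<tau> i)) \<and>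
           (\<forall>w \<in> pverts G. \<exists>!i. i \<in> {1..t} \<and> w \<in> set (P i))))"

text \<open>
  The natural-number subtractions below do not truncate as long as
  \<open>4 \<le> 2 * t \<le> d \<le> (n + t - 1) div 2\<close>.
\<close>

definition f0 :: "nat \<Rightarrow> nat \<Rightarrow> nat \<Rightarrow> nat" where
  "f0 n t d = ((n + t - d) choose 2) + (d - t) * d"

definition g0 :: "nat \<Rightarrow> nat \<Rightarrow> nat \<Rightarrow> nat" where
  "g0 n t d = (let h = (n + t - 1) div 2 in ((n + t - h) choose 2) + (h - t - 1) * h + d)"

definition h0 :: "nat \<Rightarrow> nat \<Rightarrow> nat \<Rightarrow> nat" where
  "h0 n t d = max (f0 n t d) (g0 n t d)"

lemma A_alpha_carrier: "A_alpha \<alpha> G vs \<in> carrier_mat (length vs) (length vs)"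
  by (simp add: A_alpha_def degree_matrix_def adjacency_matrix_def)

definition A_alpha_entry :: "real \<Rightarrow> 'a pair_pre_digraph \<Rightarrow> 'a \<Rightarrow> 'a \<Rightarrow> real" where
  "A_alpha_entry \<alpha> G v w = \<alpha> * (if v = w then real (out_degree G v) else 0)
     + (1 - \<alpha>) * (if (v, w) \<in> parcs G then 1 else 0)"

lemma A_alpha_index:
  assumes "distinct vs" "i < length vs" "j < length vs"
  shows "A_alpha \<alpha> G vs $$ (i, j) = A_alpha_entry \<alpha> G (vs ! i) (vs ! j)"
  using assms
  by (auto simp: A_alpha_def A_alpha_entry_def degree_matrix_def adjacency_matrix_def mat_diag_def
      nth_eq_iff_index_eq)

lemma eigenvalue_A_alpha_iff:
  assumes vs: "vs \<in> vertex_orderings G"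
  shows "eigenvalue (A_alpha \<alpha> G vs) k \<longleftrightarrow>
    (\<exists>x. (\<exists>v \<in> pverts G. x v \<noteq> 0) \<and>
         (\<forall>v \<in> pverts G. (\<Sum>w \<in> pverts G. A_alpha_entry \<alpha> G v w * x w) = k * x v))"
    (is "?L \<longleftrightarrow> ?R")
proof -
  define n where "n = length vs"
  let ?A = "A_alpha \<alpha> G vs"
  have d: "distinct vs" and V: "pverts G = set vs"
    using vs by (auto simp: vertex_orderings_def)
  have A: "?A \<in> carrier_mat n n"
    unfolding n_def by (rule A_alpha_carrier)
  have bij: "bij_betw ((!) vs) {0..<n} (pverts G)"
    using d V by (simp add: bij_betw_nth n_def atLeast0LessThan)
  have row: "(?A *\<^sub>v y) $ i = (\<Sum>w \<in> pverts G. A_alpha_entry \<alpha> G (vs ! i) w * x w)"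
    if "i < n" "y \<in> carrier_vec n" "\<And>j. j < n \<Longrightarrow> y $ j = x (vs ! j)" for y x i
  proof -
    have "(?A *\<^sub>v y) $ i = (\<Sum>j \<in> {0..<n}. ?A $$ (i, j) * y $ j)"
      using A that(1,2) by (simp add: scalar_prod_def)
    also have "\<dots> = (\<Sum>j \<in> {0..<n}. A_alpha_entry \<alpha> G (vs ! i) (vs ! j) * x (vs ! j))"
      using that d by (intro sum.cong refl) (simp add: A_alpha_index n_def)
    also have "\<dots> = (\<Sum>w \<in> pverts G. A_alpha_entry \<alpha> G (vs ! i) w * x w)"
      by (rule sum.reindex_bij_betw[OF bij])
    finally show ?thesis .
  qed
  have eig: "eigenvector ?A y k \<longleftrightarrow> (\<exists>v \<in> pverts G. x v \<noteq> 0) \<and>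
         (\<forall>v \<in> pverts G. (\<Sum>w \<in> pverts G. A_alpha_entry \<alpha> G v w * x w) = k * x v)"
    if y: "y \<in> carrier_vec n" and yx: "\<And>j. j < n \<Longrightarrow> y $ j = x (vs ! j)" for x y
  proof -
    have "y \<noteq> 0\<^sub>v n \<longleftrightarrow> (\<exists>j < n. y $ j \<noteq> 0)"
      using y by (auto simp: vec_eq_iff)
    also have "\<dots> \<longleftrightarrow> (\<exists>v \<in> pverts G. x v \<noteq> 0)"
      unfolding V n_def[symmetric] using yx by (metis in_set_conv_nth n_def)
    finally have nz: "y \<noteq> 0\<^sub>v n \<longleftrightarrow> (\<exists>v \<in> pverts G. x v \<noteq> 0)" .
    have "?A *\<^sub>v y = k \<cdot>\<^sub>v y \<longleftrightarrow> (\<forall>i < n. (?A *\<^sub>v y) $ i = k * y $ i)"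
      using A y by (auto simp: vec_eq_iff)
    also have "\<dots> \<longleftrightarrow>
        (\<forall>i < n. (\<Sum>w \<in> pverts G. A_alpha_entry \<alpha> G (vs ! i) w * x w) = k * x (vs ! i))"
      using row[OF _ y yx] yx by simp
    also have "\<dots> \<longleftrightarrow>
        (\<forall>v \<in> pverts G. (\<Sum>w \<in> pverts G. A_alpha_entry \<alpha> G v w * x w) = k * x v)"
      unfolding V all_set_conv_all_nth n_def ..
    finally show ?thesis
      using A y nz by (simp add: eigenvector_def)
  qed
  show ?thesis
  proof
    assume ?L
    then obtain y where ev: "eigenvector ?A y k"
      by (auto simp: eigenvalue_def)
    then have y: "y \<in> carrier_vec n"
      using A by (simp add: eigenvector_def)
    define x where "x v = y $ (the_inv_into {0..<n} ((!) vs) v)" for v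
    have "y $ j = x (vs ! j)" if "j < n" for j
      using that bij by (simp add: x_def bij_betw_def the_inv_into_f_f)
    then show ?R
      using eig[OF y, of x] ev by blast
  next
    assume ?R
    then obtain x where x: "\<exists>v \<in> pverts G. x v \<noteq> 0"
        "\<forall>v \<in> pverts G. (\<Sum>w \<in> pverts G. A_alpha_entry \<alpha> G v w * x w) = k * x v"
      by blast
    have "eigenvector ?A (vec n (\<lambda>j. x (vs ! j))) k"
      using eig[of "vec n (\<lambda>j. x (vs ! j))" x] x by simp
    then show ?L
      by (auto simp: eigenvalue_def)
  qed
qed

lemma spectrum_A_alpha_ordering:
  assumes "vs \<in> vertex_orderings G" "ws \<in> vertex_orderings G"
  shows "spectrum (A_alpha \<alpha> G vs) = spectrum (A_alpha \<alpha> G ws)"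
  unfolding spectrum_def eigenvalue_A_alpha_iff[OF assms(1)] eigenvalue_A_alpha_iff[OF assms(2)] ..

lemma alpha_spectral_radius_eq:
  assumes "vs \<in> vertex_orderings G"
  shows "alpha_spectral_radius \<alpha> G = Max (spectrum (A_alpha \<alpha> G vs))"
proof -
  have "(\<Union>ws \<in> vertex_orderings G. spectrum (A_alpha \<alpha> G ws)) = spectrum (A_alpha \<alpha> G vs)"
    using assms spectrum_A_alpha_ordering[OF assms] by blast
  then show ?thesis
    by (simp add: alpha_spectral_radius_def)
qed

end

theory Submission
  imports Defs
begin

text \<open>
  Fix the ends of the required paths and add edges as long as no path cover with these ends arises.
  If nonadjacent \<open>x\<close>, \<open>y\<close> become joined in a cover, exchanging segments at any crossing pair of
  arcs would remove the edge \<open>xy\<close> again; counting shows that their degrees add up to less than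
  \<open>n + t\<close>. As in Chvatal's theorem, a nonadjacent pair of maximal degree sum, the smaller degree
  being \<open>k\<close>, yields \<open>k - t\<close> vertices of degree at most \<open>k\<close>, among which a vertex of minimum
  degree may be placed. The resulting bound on the number of edges is convex in \<open>k\<close>, so it is at
  most \<open>h0\<close>.

  On the spectral side, the row sums \<open>d\<close> of the matrix \<open>A = A_alpha\<close> satisfy \<open>A d \<le> c d + K\<close>
  entrywise, where \<open>c\<close> and \<open>K\<close> are read off from the quadratic with the threshold as its larger
  root. Testing this against the absolute values of an eigenvector makes Perron-Frobenius theory
  unnecessary.
\<close>

section \<open>Path covers with prescribed ends and the exchange of segments\<close>

text \<open>Last vertices are only required to lie in the set \<open>V\<close>, so an exchange of
  tails need not track which end belongs to which path. The arc relation is a parameter because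
  edges get added while \<open>W\<close>, \<open>u\<close> and \<open>V\<close> stay fixed.\<close>

definition path_cover ::
  "'a set \<Rightarrow> ('a \<times> 'a) set \<Rightarrow> 'i set \<Rightarrow> ('i \<Rightarrow> 'a) \<Rightarrow> 'a set \<Rightarrow> ('i \<Rightarrow> 'a list) \<Rightarrow> bool" where
  "path_cover W E I u V P \<longleftrightarrow>
     (\<forall>i \<in> I. P i \<noteq> [] \<and> distinct (P i) \<and> successively (\<lambda>a b. (a, b) \<in> E) (P i) \<and>
        hd (P i) = u i \<and> last (P i) \<in> V) \<and>
     (\<forall>i \<in> I. \<forall>j \<in> I. i \<noteq> j \<longrightarrow> set (P i) \<inter> set (P j) = {}) \<and>
     (\<Union>i \<in> I. set (P i)) = W"

text \<open>Consecutive pairs are phrased as cut points \<open>C @ D\<close>, the form in which the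
  exchange arguments recombine segments.\<close>

lemma successively_if_splits:
  assumes "\<And>C D. p = C @ D \<Longrightarrow> C \<noteq> [] \<Longrightarrow> D \<noteq> [] \<Longrightarrow> R (last C) (hd D)"
  shows "successively R p"
  unfolding successively_conv_nth
proof (intro allI impI)
  fix i assume i: "Suc i < length p"
  have "p = take (Suc i) p @ drop (Suc i) p"
    by simp
  from assms[OF this] i show "R (p ! i) (p ! Suc i)"
    by (cases "p = []") (auto simp: last_conv_nth hd_drop_conv_nth)
qed

text \<open>The successor of a \<open>Y\<close> position is never an \<open>X\<close> position.
  Hence, for nonempty \<open>p\<close>, the two counts exceed \<open>length p\<close> by at most
  [X (hd p)] + [Y (last p)] - 1. This lemma and the next two estimate one or both of these boundary
  terms by 1.\<close>

lemma filter_pair_length_hd: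
  assumes "p \<noteq> []" "successively (\<lambda>s s'. \<not> (Y s \<and> X s')) p"
  shows "length (filter X p) + length (filter Y p) \<le> length p + (if X (hd p) then 1 else 0)"
  using assms by (induction p rule: induct_list012) auto

lemma filter_pair_length:
  assumes "successively (\<lambda>s s'. \<not> (Y s \<and> X s')) p"
  shows "length (filter X p) + length (filter Y p) \<le> Suc (length p)"
  using filter_pair_length_hd[OF _ assms] by (cases "p = []") (auto split: if_splits)

lemma filter_pair_length_last:
  assumes "p \<noteq> []" "successively (\<lambda>s s'. \<not> (Y s \<and> X s')) p"
  shows "length (filter X p) + length (filter Y p) \<le> length p + (if Y (last p) then 1 else 0)"
proof -
  have "successively (\<lambda>s s'. \<not> (X s \<and> Y s')) (rev p)"
    using assms(2) by (simp add: conj_commute)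
  from filter_pair_length_hd[OF _ this] show ?thesis
    using assms(1) by (simp add: rev_filter[symmetric] hd_rev)
qed

lemma successively_rev_sym:
  assumes "sym E"
  shows "successively (\<lambda>a b. (a, b) \<in> E) (rev p) = successively (\<lambda>a b. (a, b) \<in> E) p"
  using assms by (auto elim!: successively_mono dest: symD)

lemma path_cover_update:
  assumes "path_cover W E' I u V P" "i \<in> I"
    and "\<And>j. j \<in> I \<Longrightarrow> j \<noteq> i \<Longrightarrow> successively (\<lambda>a b. (a, b) \<in> E) (P j)"
    and "successively (\<lambda>a b. (a, b) \<in> E) q"
    and "distinct q" "set q = set (P i)" "hd q = hd (P i)" "last q = last (P i)"
  shows "path_cover W E I u V (P(i := q))"
proof -
  have "q \<noteq> []"
    using assms(1,2,6) by (auto simp: path_cover_def)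
  moreover have "(\<Union>j \<in> I. set ((P(i := q)) j)) = (\<Union>j \<in> I. set (P j))"
    using assms(6) by (intro SUP_cong) simp_all
  ultimately show ?thesis
    using assms unfolding path_cover_def by simp
qed

text \<open>Swapping the tails of two paths keeps the covered vertices, the disjointness and the
  initial vertices; the last vertices are interchanged but stay in \<open>V\<close>. The old cover
  may use arcs outside \<open>E\<close>: only the untouched paths and the two new ones have to run
  in \<open>E\<close>.\<close>

lemma path_cover_exchange:
  assumes P: "path_cover W E' I u V P" and ij: "i \<in> I" "j \<in> I" "i \<noteq> j"
    and E: "\<And>k. k \<in> I \<Longrightarrow> k \<noteq> i \<Longrightarrow> k \<noteq> j \<Longrightarrow> successively (\<lambda>a b. (a, b) \<in> E) (P k)"
    and Pi: "P i = A @ B" "A \<noteq> []" "B \<noteq> []"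
    and Pj: "P j = C @ D" "C \<noteq> []" "D \<noteq> []"
    and AD: "successively (\<lambda>a b. (a, b) \<in> E) (A @ D)"
    and CB: "successively (\<lambda>a b. (a, b) \<in> E) (C @ B)"
  shows "path_cover W E I u V (P(i := A @ D, j := C @ B))" (is "path_cover _ _ _ _ _ ?Q")
proof -
  have I: "I = insert i (insert j (I - {i, j}))"
    using ij by auto
  have disj: "k \<in> I \<Longrightarrow> l \<in> I \<Longrightarrow> k \<noteq> l \<Longrightarrow> set (P k) \<inter> set (P l) = {}" for k l
    using P by (auto simp: path_cover_def)
  have each: "?Q k \<noteq> [] \<and> distinct (?Q k) \<and> successively (\<lambda>a b. (a, b) \<in> E) (?Q k) \<and>
        hd (?Q k) = u k \<and> last (?Q k) \<in> V" if k: "k \<in> I" for k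
  proof -
    have "distinct (A @ B)" "distinct (C @ D)" "set (A @ B) \<inter> set (C @ D) = {}"
      "hd A = u i" "last B \<in> V" "hd C = u j" "last D \<in> V"
      using P ij Pi Pj disj[OF ij] unfolding path_cover_def by force+
    then show ?thesis
      using P k E[OF k] AD CB Pi Pj ij by (auto simp: path_cover_def)
  qed
  have cov: "(\<Union>k \<in> I. set (?Q k)) = W"
  proof -
    have "(\<Union>k \<in> I. set (?Q k)) = (\<Union>k \<in> I. set (P k))"
      by (subst (1 2) I) (use Pi Pj ij in auto)
    then show ?thesis
      using P by (simp add: path_cover_def)
  qed
  have "distinct (A @ B)" "distinct (C @ D)" "set (A @ B) \<inter> set (C @ D) = {}"
    using P ij Pi Pj disj[OF ij] unfolding path_cover_def by force+
  then have ij_disj: "set (?Q i) \<inter> set (?Q j) = {}"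
    using ij by (auto simp: disjoint_iff)
  have k_disj: "set (?Q k) \<inter> set (?Q l) = {}" if "k \<in> I" "k \<noteq> i" "k \<noteq> j" "l = i \<or> l = j" for k l
    using disj[OF that(1) ij(1)] disj[OF that(1) ij(2)] that Pi Pj ij by auto
  have "set (?Q k) \<inter> set (?Q l) = {}" if kl: "k \<in> I" "l \<in> I" "k \<noteq> l" for k l
  proof (cases "k = i \<or> k = j")
    case True
    show ?thesis
    proof (cases "l = i \<or> l = j")
      case l: True
      then have "k = i \<and> l = j \<or> k = j \<and> l = i"
        using True kl by blast
      then show ?thesis
        using ij_disj by (metis inf_commute)
    next
      case False
      then show ?thesis
        using k_disj[OF kl(2) _ _ True] by (simp only: inf_commute) blast
    qed
  next
    case k: False
    show ?thesis
    proof (cases "l = i \<or> l = j")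
      case True
      then show ?thesis
        using k_disj[OF kl(1) _ _ True] k by blast
    next
      case False
      then show ?thesis
        using k disj[OF kl] by simp
    qed
  qed
  then show ?thesis
    using each cov unfolding path_cover_def by blast
qed

section \<open>Degree sums when a single new edge creates a path cover\<close>

text \<open>\<open>P i\<close> steps from \<open>x\<close> to \<open>y\<close> between
  \<open>A\<close> and \<open>B\<close>, and everything else runs in \<open>E\<close>. Counting the
  neighbours of \<open>x\<close> and of \<open>y\<close> path by path gives at most the length plus
  one on every other path, but at most the length on \<open>P i\<close>. The lengths sum to
  \<open>card W\<close>, and the saving on \<open>P i\<close> makes the inequality strict.\<close>

lemma path_cover_degree_sum_aux:
  assumes fin: "finite W" "finite I" and "sym E" "E \<subseteq> W \<times> W"
    and loops: "(x, x) \<notin> E" "(y, y) \<notin> E"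
    and none: "\<And>Q. \<not> path_cover W E I u V Q"
    and P: "path_cover W E' I u V P" and i: "i \<in> I"
    and Pi: "P i = A @ B" "A \<noteq> []" "B \<noteq> []" "last A = x" "hd B = y"
    and A: "successively (\<lambda>a b. (a, b) \<in> E) A" and B: "successively (\<lambda>a b. (a, b) \<in> E) B"
    and other: "\<And>j. j \<in> I \<Longrightarrow> j \<noteq> i \<Longrightarrow> successively (\<lambda>a b. (a, b) \<in> E) (P j)"
  shows "card (E `` {x}) + card (E `` {y}) < card W + card I"
proof -
  define X where "X z \<longleftrightarrow> (x, z) \<in> E" for z
  define Y where "Y z \<longleftrightarrow> (y, z) \<in> E" for z
  have X': "X z \<longleftrightarrow> (z, x) \<in> E" and Y': "Y z \<longleftrightarrow> (z, y) \<in> E" for z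
    using \<open>sym E\<close> by (auto simp: X_def Y_def dest: symD)
  have dist: "distinct (P j)" if "j \<in> I" for j
    using P that by (auto simp: path_cover_def)
  have disj: "set (P k) \<inter> set (P l) = {}" if "k \<in> I" "l \<in> I" "k \<noteq> l" for k l
    using P that by (auto simp: path_cover_def)
  have W: "W = (\<Union>j \<in> I. set (P j))"
    using P by (simp add: path_cover_def)
  have dPi: "distinct (A @ B)"
    using dist[OF i] Pi by simp
  define c where "c j = length (filter X (P j)) + length (filter Y (P j))" for j
  \<comment> \<open>If \<open>s\<close> is followed by \<open>s'\<close> on \<open>P j\<close>, with
    \<open>s\<close> adjacent to \<open>y\<close> and \<open>s'\<close> adjacent to
    \<open>x\<close>, then swapping tails with \<open>P i\<close> joins \<open>x\<close> to
    \<open>s'\<close> and \<open>s\<close> to \<open>y\<close>, and the step from \<open>x\<close>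
    to \<open>y\<close> disappears.\<close>
  have c_other: "c j \<le> Suc (length (P j))" if j: "j \<in> I" "j \<noteq> i" for j
  proof -
    have "successively (\<lambda>s s'. \<not> (Y s \<and> X s')) (P j)"
    proof (rule successively_if_splits, rule notI)
      fix C D assume CD: "P j = C @ D" "C \<noteq> []" "D \<noteq> []" and XY: "Y (last C) \<and> X (hd D)"
      have "successively (\<lambda>a b. (a, b) \<in> E) (C @ D)"
        using other[OF j] CD by simp
      then have "successively (\<lambda>a b. (a, b) \<in> E) (A @ D)" "successively (\<lambda>a b. (a, b) \<in> E) (C @ B)"
        using A B Pi CD XY by (auto simp: successively_append_iff X_def Y')
      from path_cover_exchange[OF P i j(1) _ _ Pi(1-3) CD this] j other none show False
        by blast
    qed
    then show ?thesis
      unfolding c_def by (rule filter_pair_length)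
  qed
  \<comment> \<open>On \<open>A\<close> and on \<open>B\<close> the forbidden pattern is the
    opposite one: if a neighbour of \<open>x\<close> is followed by a neighbour of \<open>y\<close>,
    reversing the segment between that place and the cut bypasses the step from \<open>x\<close> to
    \<open>y\<close>. The absence of loops at \<open>x\<close> and \<open>y\<close> makes the
    boundary terms vanish.\<close>
  have c_i: "c i \<le> length (P i)"
  proof -
    have "successively (\<lambda>s s'. \<not> (X s \<and> Y s')) A"
    proof (rule successively_if_splits, rule notI)
      fix C D assume CD: "A = C @ D" "C \<noteq> []" "D \<noteq> []" and XY: "X (last C) \<and> Y (hd D)"
      have succ: "successively (\<lambda>a b. (a, b) \<in> E) (C @ rev D @ B)"
        using A B Pi CD XY
        by (simp add: successively_append_iff successively_rev_sym[OF \<open>sym E\<close>] hd_rev last_rev X' Y'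
            del: successively_rev)
      have "path_cover W E I u V (P(i := C @ rev D @ B))"
        by (rule path_cover_update[OF P i other succ]) (use dPi Pi CD in \<open>auto simp: last_append\<close>)
      with none show False
        by blast
    qed
    moreover have "\<not> X (last A)"
      using Pi loops by (simp add: X_def)
    ultimately have cA: "length (filter Y A) + length (filter X A) \<le> length A"
      using filter_pair_length_last[OF Pi(2), of X Y] Pi loops by (simp add: X_def)
    have "successively (\<lambda>s s'. \<not> (X s \<and> Y s')) B"
    proof (rule successively_if_splits, rule notI)
      fix C D assume CD: "B = C @ D" "C \<noteq> []" "D \<noteq> []" and XY: "X (last C) \<and> Y (hd D)"
      have succ: "successively (\<lambda>a b. (a, b) \<in> E) (A @ rev C @ D)"
        using A B Pi CD XY
        by (simp add: successively_append_iff successively_rev_sym[OF \<open>sym E\<close>] hd_rev last_rev X_def Y_def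
            del: successively_rev)
      have "path_cover W E I u V (P(i := A @ rev C @ D))"
        by (rule path_cover_update[OF P i other succ]) (use dPi Pi CD in \<open>auto simp: last_append\<close>)
      with none show False
        by blast
    qed
    then have cB: "length (filter Y B) + length (filter X B) \<le> length B"
      using filter_pair_length_hd[OF Pi(3), of X Y] Pi loops by (simp add: Y_def)
    show ?thesis
      using cA cB Pi by (simp add: c_def)
  qed
  have deg: "card (E `` {z}) = (\<Sum>j \<in> I. length (filter (\<lambda>w. (z, w) \<in> E) (P j)))" for z
  proof -
    have "E `` {z} = (\<Union>j \<in> I. set (filter (\<lambda>w. (z, w) \<in> E) (P j)))"
      using \<open>E \<subseteq> W \<times> W\<close> W by auto
    also have "card \<dots> = (\<Sum>j \<in> I. card (set (filter (\<lambda>w. (z, w) \<in> E) (P j))))"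
      using fin disj by (intro card_UN_disjoint) (auto simp: disjoint_iff)
    also have "\<dots> = (\<Sum>j \<in> I. length (filter (\<lambda>w. (z, w) \<in> E) (P j)))"
      by (intro sum.cong refl distinct_card distinct_filter dist)
    finally show ?thesis .
  qed
  have "card W = (\<Sum>j \<in> I. card (set (P j)))"
    unfolding W using fin disj by (intro card_UN_disjoint) auto
  also have "\<dots> = (\<Sum>j \<in> I. length (P j))"
    by (intro sum.cong refl distinct_card dist)
  also have "\<dots> = length (P i) + (\<Sum>j \<in> I - {i}. length (P j))"
    using fin i by (simp add: sum.remove)
  finally have cW: "card W = \<dots>" .
  have cI: "card I = Suc (card (I - {i}))"
    using fin i by (metis card_Suc_Diff1)
  have "card (E `` {x}) + card (E `` {y}) = (\<Sum>j \<in> I. c j)"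
    unfolding deg c_def X_def Y_def by (rule sum.distrib[symmetric])
  also have "\<dots> = c i + (\<Sum>j \<in> I - {i}. c j)"
    using fin i by (simp add: sum.remove)
  also have "\<dots> \<le> length (P i) + (\<Sum>j \<in> I - {i}. Suc (length (P j)))"
    using c_i c_other by (intro add_mono sum_mono) auto
  also have "\<dots> = card W + card (I - {i})"
    using cW by (simp add: sum_Suc)
  finally show ?thesis
    using cI by simp
qed

text \<open>Without a cover in \<open>E\<close>, some path of \<open>P\<close> uses the added edge.
  It then contains \<open>x\<close> and \<open>y\<close>, one on each side of the cut, so neither
  half nor any other path can use that edge. The two directions of traversal differ by interchanging
  \<open>x\<close> and \<open>y\<close>.\<close>

lemma path_cover_degree_sum:
  assumes fin: "finite W" "finite I" and E: "sym E" "E \<subseteq> W \<times> W"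
    and loops: "(x, x) \<notin> E" "(y, y) \<notin> E"
    and none: "\<And>Q. \<not> path_cover W E I u V Q"
    and P: "path_cover W (insert (x, y) (insert (y, x) E)) I u V P"
  shows "card (E `` {x}) + card (E `` {y}) < card W + card I"
proof -
  let ?E' = "insert (x, y) (insert (y, x) E)"
  let ?R = "\<lambda>a b. (a, b) \<in> E"
  have restrict: "successively ?R p"
    if "successively (\<lambda>a b. (a, b) \<in> ?E') p" "x \<notin> set p \<or> y \<notin> set p" for p
    using that(1) by (rule successively_mono) (use that(2) in \<open>auto dest: in_set_zipE\<close>)
  obtain i where i: "i \<in> I" "\<not> successively ?R (P i)"
    using P none unfolding path_cover_def by blast
  then obtain A B where AB: "P i = A @ B" "A \<noteq> []" "B \<noteq> []" "(last A, hd B) \<notin> E"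
    using successively_if_splits[of "P i" ?R] by blast
  have Pi: "distinct (A @ B)" "successively (\<lambda>a b. (a, b) \<in> ?E') (A @ B)"
    using P i AB unfolding path_cover_def by force+
  then have xy: "last A = x \<and> hd B = y \<or> last A = y \<and> hd B = x"
    using AB by (auto simp: successively_append_iff)
  have "last A \<in> set A" "hd B \<in> set B"
    using AB by auto
  then have mem: "x \<in> set (P i)" "y \<in> set (P i)" "x \<notin> set A \<or> y \<notin> set A" "x \<notin> set B \<or> y \<notin> set B"
    using xy Pi(1) AB(1) by (auto simp: disjoint_iff)
  have sA: "successively ?R A" and sB: "successively ?R B"
    using Pi(2) mem by (auto simp: successively_append_iff intro!: restrict)
  have other: "successively ?R (P j)" if "j \<in> I" "j \<noteq> i" for j
  proof (rule restrict)
    show "successively (\<lambda>a b. (a, b) \<in> ?E') (P j)"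
      using P that by (simp add: path_cover_def)
    have "set (P i) \<inter> set (P j) = {}"
      using P that i by (auto simp: path_cover_def)
    then show "x \<notin> set (P j) \<or> y \<notin> set (P j)"
      using mem by auto
  qed
  show ?thesis
    using xy
  proof
    assume "last A = x \<and> hd B = y"
    then show ?thesis
      using path_cover_degree_sum_aux[OF fin E loops none P i(1) AB(1-3) _ _ sA sB other] by blast
  next
    assume "last A = y \<and> hd B = x"
    then show ?thesis
      using path_cover_degree_sum_aux[OF fin E loops(2,1) none P i(1) AB(1-3) _ _ sA sB other]
      by simp
  qed
qed

section \<open>Counting the arcs of a graph without a path cover\<close>

lemma successively_complete:
  assumes "distinct p" "set p \<subseteq> W"
  shows "successively (\<lambda>a b. (a, b) \<in> W \<times> W - Id) p"
  using assms by (induction p rule: induct_list012) auto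

lemma path_cover_complete:
  assumes W: "finite W" "u ` I \<subseteq> W" "v ` I \<subseteq> W" "u ` I \<inter> v ` I = {}"
    and inj: "inj_on u I" "inj_on v I" and "I \<noteq> {}"
  shows "\<exists>P. path_cover W (W \<times> W - Id) I u (v ` I) P"
proof -
  obtain i0 where i0: "i0 \<in> I"
    using \<open>I \<noteq> {}\<close> by blast
  obtain xs where xs: "set xs = W - u ` I - v ` I" "distinct xs"
    using finite_distinct_list[of "W - u ` I - v ` I"] W by auto
  \<comment> \<open>All vertices that are not ends go onto the single path \<open>i0\<close>; any
    order works in the complete relation.\<close>
  define P where "P i = u i # (if i = i0 then xs else []) @ [v i]" for i
  have uv: "u i \<noteq> v j" if "i \<in> I" "j \<in> I" for i j
    using W(4) that by (metis disjoint_iff imageI)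
  have uu: "u i = u j \<longleftrightarrow> i = j" and vv: "v i = v j \<longleftrightarrow> i = j" if "i \<in> I" "j \<in> I" for i j
    using inj that by (auto simp: inj_on_eq_iff)
  have dist: "distinct (P i)" if "i \<in> I" for i
    using xs uv[OF that that] that by (auto simp: P_def)
  have sub: "set (P i) \<subseteq> W" if "i \<in> I" for i
    using xs W that by (auto simp: P_def)
  have disj: "set (P i) \<inter> set (P j) = {}" if "i \<in> I" "j \<in> I" "i \<noteq> j" for i j
    using that xs uu[OF that(1,2)] vv[OF that(1,2)] uv[OF that(1,2)] uv[OF that(2,1)]
    by (auto simp: P_def)
  have "W \<subseteq> (\<Union>i \<in> I. set (P i))"
    using xs i0 by (auto simp: P_def)
  then have "path_cover W (W \<times> W - Id) I u (v ` I) P"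
    unfolding path_cover_def using dist sub disj successively_complete[OF dist sub]
    by (auto simp: P_def)
  then show ?thesis
    by blast
qed

text \<open>An arc starts in \<open>S\<close>, or ends in \<open>S\<close>, or has both ends in
  \<open>W - S\<close>. By symmetry the arcs of the second kind are reversals of arcs of the
  first.\<close>

lemma card_arcs_le:
  assumes W: "finite W" "S \<subseteq> W" and E: "sym E" "E \<subseteq> W \<times> W - Id"
  shows "card E \<le> 2 * (\<Sum>v \<in> S. card (E `` {v})) + (card W - card S) * (card W - card S - 1)"
proof -
  define T where "T = W - S"
  define F where "F = (SIGMA v : S. E `` {v})"
  have fin: "finite T" "finite S" "finite E" "finite F"
    using W E finite_subset[of E "W \<times> W"] by (auto simp: T_def F_def intro: finite_subset)
  have card_T: "card T = card W - card S"
    using W by (auto simp: T_def card_Diff_subset finite_subset)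
  have "E \<subseteq> F \<union> F\<inverse> \<union> (T \<times> T - Id_on T)"
  proof
    fix e assume "e \<in> E"
    then show "e \<in> F \<union> F\<inverse> \<union> (T \<times> T - Id_on T)"
      using E by (cases e) (auto simp: F_def T_def dest: symD)
  qed
  then have "card E \<le> card (F \<union> F\<inverse> \<union> (T \<times> T - Id_on T))"
    using fin by (intro card_mono) auto
  also have "\<dots> \<le> card F + card (F\<inverse>) + card (T \<times> T - Id_on T)"
    by (meson add_right_mono card_Un_le order_trans)
  also have "card (F\<inverse>) = card F"
    by (rule card_inverse)
  also have "card F = (\<Sum>v \<in> S. card (E `` {v}))"
    unfolding F_def using fin by (intro card_SigmaI) auto
  also have "card (T \<times> T - Id_on T) = card T * (card T - 1)"
  proof -
    have "Id_on T = (\<lambda>a. (a, a)) ` T"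
      by auto
    then have "card (Id_on T) = card T" "finite (Id_on T)"
      using fin by (simp_all add: card_image inj_on_def)
    then show ?thesis
      using fin by (subst card_Diff_subset) (auto simp: card_cartesian_product diff_mult_distrib2)
  qed
  finally show ?thesis
    by (simp add: card_T)
qed

text \<open>\<open>E\<close> is enlarged to an inclusion-maximal relation \<open>H\<close> without a
  cover. The nonneighbours in \<open>H\<close> of a suitable vertex have small degree in
  \<open>H\<close>, and degrees can only drop on returning to \<open>E\<close>, where the arcs are
  counted.\<close>

lemma not_path_cover_card_arcs:
  fixes W :: "'a set" and u v :: "nat \<Rightarrow> 'a"
  assumes W: "finite W" "card W = n" and E: "sym E" "E \<subseteq> W \<times> W - Id"
    and uv: "u ` I \<subseteq> W" "v ` I \<subseteq> W" "u ` I \<inter> v ` I = {}" "inj_on u I" "inj_on v I"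
    and I: "finite I" "I \<noteq> {}" "card I = t" and "t < d"
    and deg: "\<And>w. w \<in> W \<Longrightarrow> d \<le> card (E `` {w})" and z: "z \<in> W" "card (E `` {z}) = d"
    and none: "\<And>P. \<not> path_cover W E I u (v ` I) P"
  obtains k where "d \<le> k" "2 * k < n + t"
    "card E \<le> (n + t - k) * (n + t - k - 1) + 2 * ((k - t - 1) * k + d)"
proof -
  define C where "C = W \<times> W - Id"
  define \<H> where "\<H> = {H. E \<subseteq> H \<and> H \<subseteq> C \<and> sym H \<and> (\<forall>P. \<not> path_cover W H I u (v ` I) P)}"
  have finC: "finite C"
    using W by (simp add: C_def)
  then have "finite \<H>"
    by (rule finite_subset[rotated, OF finite_Pow_iff[THEN iffD2]]) (auto simp: \<H>_def)
  moreover have "E \<in> \<H>"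
    using E none by (auto simp: \<H>_def C_def)
  ultimately obtain H where H: "H \<in> \<H>" and maxH: "\<And>H'. H' \<in> \<H> \<Longrightarrow> H \<subseteq> H' \<Longrightarrow> H = H'"
    using finite_has_maximal2[of \<H> E] by auto
  have EH: "E \<subseteq> H" and HC: "H \<subseteq> C" and symH: "sym H"
    and noneH: "\<And>P. \<not> path_cover W H I u (v ` I) P"
    using H by (auto simp: \<H>_def)
  have finH: "finite (H `` {w})" for w
    by (rule finite_subset[OF _ W(1)]) (use HC in \<open>auto simp: C_def\<close>)
  define f where "f w = card (H `` {w})" for w
  have Ef: "card (E `` {w}) \<le> f w" for w
    unfolding f_def using finH EH by (intro card_mono) auto
  \<comment> \<open>By maximality of \<open>H\<close>, adding the pair creates a cover.\<close>
  have ore: "f x + f y < n + t" if xy: "(x, y) \<in> C - H" for x y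
  proof -
    let ?H' = "insert (x, y) (insert (y, x) H)"
    have "?H' \<notin> \<H>"
      using maxH[of ?H'] xy by blast
    moreover have "E \<subseteq> ?H'" "?H' \<subseteq> C" "sym ?H'"
      using EH HC symH xy by (auto simp: C_def sym_def)
    ultimately obtain P where P: "path_cover W ?H' I u (v ` I) P"
      by (auto simp: \<H>_def)
    have "card (H `` {x}) + card (H `` {y}) < card W + card I"
      by (rule path_cover_degree_sum[OF W(1) I(1) symH _ _ _ noneH P]) (use HC in \<open>auto simp: C_def\<close>)
    then show ?thesis
      using W I by (simp add: f_def)
  qed
  \<comment> \<open>The complete relation has a cover, so some nonadjacent pair is left over which
    the degree sum can be maximised.\<close>
  have "H \<noteq> C"
    using noneH path_cover_complete[OF W(1) uv I(2)] by (auto simp: C_def)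
  then have ne: "C - H \<noteq> {}"
    using HC by blast
  define g where "g e = f (fst e) + f (snd e)" for e
  have "Max (g ` (C - H)) \<in> g ` (C - H)"
    using finC ne by (intro Max_in) auto
  then obtain e where e: "e \<in> C - H" "\<And>e'. e' \<in> C - H \<Longrightarrow> g e' \<le> g e"
    using finC by (metis (no_types, lifting) Max_ge finite_Diff finite_imageI imageE imageI)
  obtain x y where xy: "(x, y) \<in> C - H" "f x \<le> f y"
    and max: "\<And>a b. (a, b) \<in> C - H \<Longrightarrow> f a + f b \<le> f x + f y"
  proof (cases "f (fst e) \<le> f (snd e)")
    case True
    then show ?thesis
      using that[of "fst e" "snd e"] e by (auto simp: g_def)
  next
    case False
    have "(snd e, fst e) \<in> C - H"
      using e(1) symH by (cases e) (auto simp: C_def dest: symD)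
    then show ?thesis
      using that[of "snd e" "fst e"] e(2) False by (auto simp: g_def add.commute)
  qed
  define k where "k = f x"
  have "d \<le> k"
    using deg[of x] Ef[of x] xy by (auto simp: k_def C_def)
  have "k + f y < n + t"
    using ore[OF xy(1)] by (simp add: k_def)
  then have k2: "2 * k < n + t"
    using xy(2) by (simp add: k_def)
  \<comment> \<open>The maximal degree sum of \<open>x\<close> and \<open>y\<close> bounds the
    degree of each nonneighbour of \<open>y\<close> by \<open>k\<close>. There are
    \<open>n - 1 - f y\<close> of them, which is at least \<open>k - t\<close>.\<close>
  define S0 where "S0 = {w. (w, y) \<in> C - H}"
  have "W = insert y (S0 \<union> H `` {y})" "y \<notin> S0 \<union> H `` {y}" "S0 \<inter> H `` {y} = {}"
    using xy HC symH by (auto simp: S0_def C_def dest: symD)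
  moreover have "finite S0"
    by (rule finite_subset[OF _ W(1)]) (auto simp: S0_def C_def)
  ultimately have "card W = Suc (card S0 + f y)"
    using finH[of y] by (metis card_Un_disjoint card_insert_disjoint f_def finite_UnI)
  then have "k - t \<le> card S0"
    using \<open>k + f y < n + t\<close> W by linarith
  \<comment> \<open>One of the \<open>k - t\<close> places is reserved for \<open>z\<close>, whether
    or not it lies in \<open>S0\<close>. Its degree in \<open>E\<close> is exactly \<open>d\<close>,
    although it may be larger in \<open>H\<close>, so one term \<open>k\<close> of the bound
    improves to \<open>d\<close>.\<close>
  then have "k - t - 1 \<le> card (S0 - {z})"
    unfolding card_Diff_singleton_if by (cases "z \<in> S0") simp_all
  then obtain S1 where S1: "S1 \<subseteq> S0 - {z}" "card S1 = k - t - 1"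
    by (metis obtain_subset_with_card_n)
  have "finite S1"
    using S1(1) \<open>finite S0\<close> by (meson finite_Diff finite_subset)
  have S1k: "card (E `` {w}) \<le> k" if "w \<in> S1" for w
    using max[of w y] Ef[of w] S1 that by (force simp: S0_def k_def)
  define S where "S = insert z S1"
  have card_S: "card S = k - t"
    using S1 \<open>finite S1\<close> \<open>d \<le> k\<close> \<open>t < d\<close> by (subst S_def, subst card_insert_disjoint) auto
  have "S \<subseteq> W"
    using z S1 by (auto simp: S_def S0_def C_def)
  have "(\<Sum>w \<in> S. card (E `` {w})) = d + (\<Sum>w \<in> S1. card (E `` {w}))"
    unfolding S_def using S1 \<open>finite S1\<close> z by (subst sum.insert) auto
  also have "\<dots> \<le> d + card S1 * k"
    using sum_bounded_above[of S1 "\<lambda>w. card (E `` {w})" k] S1k by simp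
  finally have sum_S: "(\<Sum>w \<in> S. card (E `` {w})) \<le> (k - t - 1) * k + d"
    by (simp add: S1)
  have nk: "card W - card S = n + t - k"
    using card_S W \<open>d \<le> k\<close> \<open>t < d\<close> by simp
  have "card E \<le> 2 * (\<Sum>w \<in> S. card (E `` {w})) + (n + t - k) * (n + t - k - 1)"
    using card_arcs_le[OF W(1) \<open>S \<subseteq> W\<close> E] unfolding nk .
  also have "\<dots> \<le> 2 * ((k - t - 1) * k + d) + (n + t - k) * (n + t - k - 1)"
    using sum_S by (intro add_right_mono mult_le_mono2)
  finally have "card E \<le> (n + t - k) * (n + t - k - 1) + 2 * ((k - t - 1) * k + d)"
    by (simp only: add.commute)
  then show ?thesis
    using that \<open>d \<le> k\<close> k2 by blast
qed

section \<open>The extreme values of the arc bound\<close>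

lemma two_times_choose_two: "2 * (m choose 2) = m * (m - 1)"
  unfolding choose_two by (cases m) simp_all

text \<open>The bound is a quadratic in \<open>k\<close> with leading coefficient 3, hence largest
  at an end of the range from \<open>d\<close> to \<open>h\<close>. These ends give twice
  \<open>f0\<close> and twice \<open>g0\<close>.\<close>

lemma arcs_bound_le_h0:
  assumes "t < d" "d \<le> k" "2 * k < n + t"
  shows "(n + t - k) * (n + t - k - 1) + 2 * ((k - t - 1) * k + d) \<le> 2 * h0 n t d"
proof -
  define h where "h = (n + t - 1) div 2"
  define q where "q k = (n + t - k) * (n + t - k - 1) + 2 * ((k - t - 1) * k + d)" for k
  define r where "r = 2 * int n + 4 * int t + 1"
  have kh: "k \<le> h" and h2: "2 * h < n + t"
    using assms by (auto simp: h_def)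
  have q: "int (q j) = 3 * (int j)\<^sup>2 - r * int j + (int n + int t) * (int n + int t - 1) + 2 * int d"
    if "d \<le> j" "2 * j < n + t" for j
  proof -
    have "int (n + t - j) = int n + int t - int j" "int (n + t - j - 1) = int n + int t - int j - 1"
      "int (j - t - 1) = int j - int t - 1"
      using that assms by auto
    then show ?thesis
      unfolding q_def of_nat_add of_nat_mult by (simp add: r_def algebra_simps power2_eq_square)
  qed
  have diff: "int (q k) - int (q j) = (int k - int j) * (3 * (int k + int j) - r)"
    if "d \<le> j" "2 * j < n + t" for j
    unfolding q[OF that] q[OF assms(2,3)] by (simp add: algebra_simps power2_eq_square)
  have "q k \<le> q d \<or> q k \<le> q h"
  proof (rule ccontr)
    \<comment> \<open>Exceeding both end values would force
      \<open>3 * (k + h) < r < 3 * (k + d)\<close>, against \<open>d <= h\<close>.\<close>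
    assume "\<not> ?thesis"
    then have "0 < (int k - int d) * (3 * (int k + int d) - r)"
      "0 < (int k - int h) * (3 * (int k + int h) - r)"
      using diff[of d] diff[of h] assms kh h2 by auto
    then have "0 < 3 * (int k + int d) - r" "3 * (int k + int h) - r < 0"
      using assms kh by (auto simp: zero_less_mult_iff)
    then show False
      using assms kh by simp
  qed
  moreover have "q d = 2 * f0 n t d"
  proof -
    have "(d - t - 1) * d + d = (d - t) * d"
      using assms by (metis Suc_diff_Suc diff_Suc_eq_diff_pred mult_Suc add.commute minus_nat.diff_0 diff_commute)
    then show ?thesis
      unfolding q_def f0_def add_mult_distrib2 two_times_choose_two by simp
  qed
  moreover have "q h = 2 * g0 n t d"
    unfolding q_def g0_def Let_def h_def[symmetric] add_mult_distrib2 two_times_choose_two by simp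
  ultimately show ?thesis
    unfolding h0_def q_def[symmetric] by auto
qed

section \<open>The spectral radius as a real eigenvalue\<close>

text \<open>For a complex eigenvector \<open>v\<close> the Hermitian form \<open>s\<close> of
  \<open>A\<close> at \<open>v\<close> is real by symmetry and equals \<open>k\<close> times the
  positive number \<open>N\<close>, so \<open>k\<close> is real. The real or the imaginary part of
  \<open>v\<close> is then a real eigenvector.\<close>

lemma symmetric_real_mat_eigenvalue:
  fixes A :: "real mat"
  assumes A: "A \<in> carrier_mat n n" and "0 < n"
    and sym: "\<And>i j. i < n \<Longrightarrow> j < n \<Longrightarrow> A $$ (i, j) = A $$ (j, i)"
  shows "\<exists>k. eigenvalue A k"
proof -
  let ?C = "map_mat complex_of_real A"
  have C: "?C \<in> carrier_mat n n"
    using A by simp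
  obtain k v where v: "v \<in> carrier_vec n" "v \<noteq> 0\<^sub>v n" and Cv: "?C *\<^sub>v v = k \<cdot>\<^sub>v v"
    using spectrum_non_empty[OF C \<open>0 < n\<close>] A
    by (auto simp: spectrum_def eigenvalue_def eigenvector_def)
  have row: "(\<Sum>j < n. complex_of_real (A $$ (i, j)) * v $ j) = k * v $ i" if "i < n" for i
  proof -
    have "(?C *\<^sub>v v) $ i = k * v $ i"
      using Cv v that by simp
    then show ?thesis
      using that A v by (simp add: scalar_prod_def atLeast0LessThan)
  qed
  define N where "N = (\<Sum>i < n. (cmod (v $ i))\<^sup>2)"
  define s where "s = (\<Sum>i < n. cnj (v $ i) * (\<Sum>j < n. complex_of_real (A $$ (i, j)) * v $ j))"
  have "s = (\<Sum>i < n. k * (cnj (v $ i) * v $ i))"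
    unfolding s_def by (intro sum.cong refl) (simp add: row mult.left_commute)
  also have "\<dots> = k * complex_of_real N"
    unfolding N_def of_real_sum sum_distrib_left complex_norm_square
    by (intro sum.cong refl) (simp add: mult.commute)
  finally have sN: "s = k * complex_of_real N" .
  have "cnj s = (\<Sum>i < n. \<Sum>j < n. complex_of_real (A $$ (i, j)) * (v $ i * cnj (v $ j)))"
    by (simp add: s_def sum_distrib_left mult_ac)
  also have "\<dots> = (\<Sum>j < n. \<Sum>i < n. complex_of_real (A $$ (i, j)) * (v $ i * cnj (v $ j)))"
    by (rule sum.swap)
  also have "\<dots> = s"
    unfolding s_def sum_distrib_left
    by (intro sum.cong refl) (auto simp: sym mult_ac)
  finally have "cnj s = s" .
  obtain i0 where i0: "i0 < n" "v $ i0 \<noteq> 0"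
    using v by (auto simp: vec_eq_iff)
  have "(cmod (v $ i0))\<^sup>2 \<le> N"
    unfolding N_def using i0 by (intro member_le_sum) auto
  moreover have "0 < (cmod (v $ i0))\<^sup>2"
    using i0 by simp
  ultimately have "N \<noteq> 0"
    by linarith
  have "k \<in> \<real>"
  proof -
    have "cnj k * complex_of_real N = k * complex_of_real N"
      using \<open>cnj s = s\<close> unfolding sN by simp
    then show ?thesis
      using \<open>N \<noteq> 0\<close> by (simp add: Reals_cnj_iff)
  qed
  then obtain r where r: "k = complex_of_real r"
    by (auto elim: Reals_cases)
  have part: "eigenvector A w r"
    if "\<And>i. i < n \<Longrightarrow> w $ i = p (v $ i)" "w \<in> carrier_vec n" "w \<noteq> 0\<^sub>v n"
      and p: "p = Re \<or> p = Im" for w p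
  proof -
    have "(\<Sum>j < n. A $$ (i, j) * p (v $ j)) = r * p (v $ i)" if "i < n" for i
      using arg_cong[OF row[OF that], of p] p by (auto simp: r Re_sum Im_sum)
    then have "A *\<^sub>v w = r \<cdot>\<^sub>v w"
      using A that by (auto simp: vec_eq_iff scalar_prod_def atLeast0LessThan)
    then show ?thesis
      using A that by (simp add: eigenvector_def)
  qed
  show ?thesis
  proof (cases "Re (v $ i0) = 0")
    case False
    then have "eigenvector A (vec n (\<lambda>i. Re (v $ i))) r"
      using i0 by (intro part[of _ Re]) (auto simp: vec_eq_iff)
    then show ?thesis
      by (auto simp: eigenvalue_def)
  next
    case True
    then have "Im (v $ i0) \<noteq> 0"
      using i0 by (simp add: complex_eq_iff)
    then have "eigenvector A (vec n (\<lambda>i. Im (v $ i))) r"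
      using i0 by (intro part[of _ Im]) (auto simp: vec_eq_iff)
    then show ?thesis
      by (auto simp: eigenvalue_def)
  qed
qed

lemma A_alpha_entry_commute:
  fixes G :: "'a pair_pre_digraph"
  assumes "symmetric G"
  shows "A_alpha_entry \<alpha> G v w = A_alpha_entry \<alpha> G w v"
  using assms by (auto simp: A_alpha_entry_def symmetric_def dest: symD)

text \<open>The value of \<open>Max\<close> is meaningful only on a finite nonempty set;
  nonemptiness of the real spectrum comes from symmetry.\<close>

lemma alpha_spectral_radius_eigenvector:
  fixes G :: "'a pair_pre_digraph"
  assumes "finite (pverts G)" "pverts G \<noteq> {}" and sym: "symmetric G"
  obtains x where "\<exists>v \<in> pverts G. x v \<noteq> 0"
    and "\<And>v. v \<in> pverts G \<Longrightarrow>
      (\<Sum>w \<in> pverts G. A_alpha_entry \<alpha> G v w * x w) = alpha_spectral_radius \<alpha> G * x v"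
proof -
  obtain vs where vs: "set vs = pverts G" "distinct vs"
    using finite_distinct_list assms by blast
  then have ord: "vs \<in> vertex_orderings G" and "0 < length vs"
    using assms by (auto simp: vertex_orderings_def)
  have "\<exists>k. eigenvalue (A_alpha \<alpha> G vs) k"
    using A_alpha_carrier \<open>0 < length vs\<close>
    by (rule symmetric_real_mat_eigenvalue)
      (simp add: A_alpha_index[OF vs(2)] A_alpha_entry_commute[OF sym])
  then have "spectrum (A_alpha \<alpha> G vs) \<noteq> {}"
    by (auto simp: spectrum_def)
  then have "Max (spectrum (A_alpha \<alpha> G vs)) \<in> spectrum (A_alpha \<alpha> G vs)"
    using card_finite_spectrum[OF A_alpha_carrier] by (intro Max_in)
  then have "eigenvalue (A_alpha \<alpha> G vs) (alpha_spectral_radius \<alpha> G)"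
    by (simp add: alpha_spectral_radius_eq[OF ord] spectrum_def)
  then show ?thesis
    using that unfolding eigenvalue_A_alpha_iff[OF ord] by blast
qed

section \<open>Degrees, row sums and the quadratic inequality\<close>

lemma (in pair_graph) out_degree_eq_card_neighbours:
  "out_degree G v = card (parcs G `` {v})"
proof -
  have "out_arcs G v = Pair v ` (parcs G `` {v})"
    by (auto simp: out_arcs_def)
  then show ?thesis
    by (simp add: out_degree_def card_image inj_on_def)
qed

lemma (in pair_graph) finite_neighbours: "finite (parcs G `` {v})"
  by (simp add: pair_finite_arcs)

lemma (in pair_graph) sum_out_degree: "(\<Sum>v \<in> pverts G. out_degree G v) = card (parcs G)"
proof -
  have "parcs G = (SIGMA v : pverts G. parcs G `` {v})"
    by (auto dest: in_arcsD1)
  then show ?thesis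
    using finite_neighbours pair_finite_verts
    by (metis (no_types, lifting) card_SigmaI out_degree_eq_card_neighbours sum.cong)
qed

lemma (in pair_graph) A_alpha_row_sum:
  fixes f :: "'a \<Rightarrow> real"
  assumes "v \<in> pverts G"
  shows "(\<Sum>w \<in> pverts G. A_alpha_entry \<alpha> G v w * f w) =
    \<alpha> * real (out_degree G v) * f v + (1 - \<alpha>) * (\<Sum>w \<in> parcs G `` {v}. f w)"
proof -
  have "(\<Sum>w \<in> pverts G. A_alpha_entry \<alpha> G v w * f w) =
      (\<Sum>w \<in> pverts G. if v = w then \<alpha> * real (out_degree G v) * f w else 0) +
      (1 - \<alpha>) * (\<Sum>w \<in> pverts G. if (v, w) \<in> parcs G then f w else 0)"
    unfolding sum_distrib_left sum.distrib[symmetric]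
    by (intro sum.cong refl) (auto simp: A_alpha_entry_def algebra_simps)
  also have "(\<Sum>w \<in> pverts G. if v = w then \<alpha> * real (out_degree G v) * f w else 0) =
      \<alpha> * real (out_degree G v) * f v"
    using assms pair_finite_verts by simp
  also have "(\<Sum>w \<in> pverts G. if (v, w) \<in> parcs G then f w else 0) = (\<Sum>w \<in> parcs G `` {v}. f w)"
  proof -
    have "parcs G `` {v} = {w \<in> pverts G. (v, w) \<in> parcs G}"
      by (auto dest: in_arcsD2)
    then show ?thesis
      using pair_finite_verts by (simp add: sum.inter_filter)
  qed
  finally show ?thesis .
qed

text \<open>The degrees of all vertices sum to the number of arcs, and each vertex other than
  \<open>v\<close> and its neighbours contributes at least \<open>d\<close>.\<close>

lemma (in pair_graph) sum_neighbour_degrees_le: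
  assumes v: "v \<in> pverts G" and deg: "\<And>w. w \<in> pverts G \<Longrightarrow> d \<le> out_degree G w"
  shows "(\<Sum>w \<in> parcs G `` {v}. real (out_degree G w)) + real (out_degree G v) +
    (real (card (pverts G)) - 1 - real (out_degree G v)) * real d \<le> real (card (parcs G))"
proof -
  define N where "N = parcs G `` {v}"
  define R where "R = pverts G - insert v N"
  have N: "finite N" "v \<notin> N" "N \<subseteq> pverts G" "card N = out_degree G v"
    using finite_neighbours pair_no_loops[of "(v, v)"]
    by (auto simp: N_def out_degree_eq_card_neighbours dest: in_arcsD2)
  have R: "pverts G = insert v N \<union> R" "insert v N \<inter> R = {}" "finite R"
    using N v pair_finite_verts by (auto simp: R_def)
  have "card (pverts G) = Suc (card N) + card R"
    using N R by (metis card_Un_disjoint card_insert_disjoint finite_insert)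
  then have cR: "real (card R) = real (card (pverts G)) - 1 - real (out_degree G v)"
    using N by simp
  have "real (card R) * real d \<le> (\<Sum>w \<in> R. real (out_degree G w))"
    using deg R by (intro sum_bounded_below) auto
  moreover have "(\<Sum>w \<in> pverts G. real (out_degree G w)) = (\<Sum>w \<in> N. real (out_degree G w)) +
      real (out_degree G v) + (\<Sum>w \<in> R. real (out_degree G w))"
    using N R(2,3) by (subst R(1)) (simp add: sum.union_disjoint)
  moreover have "(\<Sum>w \<in> pverts G. real (out_degree G w)) = real (card (parcs G))"
    by (metis of_nat_sum sum_out_degree)
  ultimately show ?thesis
    by (simp add: cR N_def)
qed

text \<open>Pairing \<open>L y <= A y\<close> with the constant 1 gives \<open>L * s0 <= s1\<close>,
  and pairing it with the degrees gives \<open>L * s1 <= c * s1 + K * s0\<close>. Since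
  \<open>c < L\<close>, the first inequality can be inserted into the second, and
  \<open>s0 > 0\<close> cancels.\<close>

lemma (in pair_graph) alpha_spectral_radius_quadratic:
  fixes \<alpha> :: real and d n :: nat
  defines "n \<equiv> card (pverts G)"
  defines "c \<equiv> real d + \<alpha> * real n - \<alpha> * real d - 1"
  defines "K \<equiv> (1 - \<alpha>) * (real (card (parcs G)) - real n * real d + real d)"
  assumes ne: "pverts G \<noteq> {}" and \<alpha>: "0 \<le> \<alpha>" "\<alpha> < 1"
    and deg: "\<And>w. w \<in> pverts G \<Longrightarrow> d \<le> out_degree G w"
    and c: "c < alpha_spectral_radius \<alpha> G"
  shows "(alpha_spectral_radius \<alpha> G - c) * alpha_spectral_radius \<alpha> G \<le> K"
proof -
  define L where "L = alpha_spectral_radius \<alpha> G"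
  define a where "a = A_alpha_entry \<alpha> G"
  define D where "D v = real (out_degree G v)" for v
  let ?V = "pverts G"
  obtain x where x: "\<exists>v \<in> ?V. x v \<noteq> 0" "\<And>v. v \<in> ?V \<Longrightarrow> (\<Sum>w \<in> ?V. a v w * x w) = L * x v"
    using alpha_spectral_radius_eigenvector[OF pair_finite_verts ne pair_sym_arcs]
    unfolding a_def L_def by blast
  define y where "y v = \<bar>x v\<bar>" for v
  have a0: "0 \<le> a v w" for v w
    using \<alpha> by (simp add: a_def A_alpha_entry_def)
  have y0: "0 \<le> y v" for v
    by (simp add: y_def)
  have comm: "a v w = a w v" for v w
    unfolding a_def by (rule A_alpha_entry_commute[OF pair_sym_arcs])
  \<comment> \<open>The entries are nonnegative, and \<open>L * y v\<close> is at most the absolute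
    value of \<open>L * x v\<close> for either sign of \<open>L\<close>.\<close>
  have sub: "L * y v \<le> (\<Sum>w \<in> ?V. a v w * y w)" if "v \<in> ?V" for v
  proof -
    have "L * y v \<le> \<bar>L * x v\<bar>"
      by (simp add: y_def abs_mult mult_right_mono)
    also have "\<dots> = \<bar>\<Sum>w \<in> ?V. a v w * x w\<bar>"
      using x that by simp
    also have "\<dots> \<le> (\<Sum>w \<in> ?V. \<bar>a v w * x w\<bar>)"
      by (rule sum_abs)
    also have "\<dots> = (\<Sum>w \<in> ?V. a v w * y w)"
      using a0 by (simp add: y_def abs_mult)
    finally show ?thesis .
  qed
  \<comment> \<open>Symmetry moves the matrix from \<open>y\<close> to the test function
    \<open>f\<close>.\<close>
  have test: "L * (\<Sum>v \<in> ?V. f v * y v) \<le> (\<Sum>w \<in> ?V. (\<Sum>v \<in> ?V. a w v * f v) * y w)"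
    if "\<And>v. 0 \<le> f v" for f
  proof -
    have "L * (\<Sum>v \<in> ?V. f v * y v) = (\<Sum>v \<in> ?V. f v * (L * y v))"
      by (simp add: sum_distrib_left mult_ac)
    also have "\<dots> \<le> (\<Sum>v \<in> ?V. f v * (\<Sum>w \<in> ?V. a v w * y w))"
      using sub that by (intro sum_mono mult_left_mono) auto
    also have "\<dots> = (\<Sum>v \<in> ?V. \<Sum>w \<in> ?V. a w v * f v * y w)"
      by (simp add: sum_distrib_left comm mult_ac)
    also have "\<dots> = (\<Sum>w \<in> ?V. \<Sum>v \<in> ?V. a w v * f v * y w)"
      by (rule sum.swap)
    finally show ?thesis
      by (simp add: sum_distrib_right)
  qed
  have row1: "(\<Sum>v \<in> ?V. a w v * 1) = D w" if "w \<in> ?V" for w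
    using A_alpha_row_sum[OF that, of \<alpha> "\<lambda>_. 1"]
    by (simp add: a_def D_def out_degree_eq_card_neighbours algebra_simps)
  \<comment> \<open>One factor of the squared degree is estimated by \<open>n - 1\<close> and the
    neighbour degrees by the preceding lemma. Collecting the coefficient of \<open>D w\<close> and
    the constant term yields exactly \<open>c\<close> and \<open>K\<close>.\<close>
  have row2: "(\<Sum>v \<in> ?V. a w v * D v) \<le> c * D w + K" if w: "w \<in> ?V" for w
  proof -
    have "(\<Sum>v \<in> ?V. a w v * D v) = \<alpha> * D w * D w + (1 - \<alpha>) * (\<Sum>v \<in> parcs G `` {w}. D v)"
      using A_alpha_row_sum[OF w, of \<alpha> D] by (simp add: a_def D_def)
    also have "\<dots> \<le> \<alpha> * D w * (real n - 1) +
        (1 - \<alpha>) * (real (card (parcs G)) - D w - (real n - 1 - D w) * real d)"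
    proof (intro add_mono mult_left_mono)
      have "parcs G `` {w} \<subseteq> ?V - {w}"
        using pair_no_loops[of "(w, w)"] by (auto dest: in_arcsD2)
      then have "card (parcs G `` {w}) \<le> card (?V - {w})"
        using pair_finite_verts by (intro card_mono) auto
      then show "D w \<le> real n - 1"
        using w pair_finite_verts card_gt_0_iff[of ?V]
        by (auto simp: D_def out_degree_eq_card_neighbours n_def)
      show "(\<Sum>v \<in> parcs G `` {w}. D v) \<le> real (card (parcs G)) - D w - (real n - 1 - D w) * real d"
        using sum_neighbour_degrees_le[OF w deg] by (simp add: D_def n_def)
    qed (use \<alpha> in \<open>auto simp: D_def\<close>)
    also have "\<dots> = c * D w + K"
      by (simp add: c_def K_def algebra_simps)
    finally show ?thesis .
  qed
  define s0 where "s0 = (\<Sum>v \<in> ?V. y v)"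
  define s1 where "s1 = (\<Sum>v \<in> ?V. D v * y v)"
  have L0: "L * s0 \<le> s1"
    using test[of "\<lambda>_. 1"] row1 by (simp add: s0_def s1_def)
  have "L * s1 \<le> (\<Sum>w \<in> ?V. (\<Sum>v \<in> ?V. a w v * D v) * y w)"
    unfolding s1_def by (rule test) (simp add: D_def)
  also have "\<dots> \<le> (\<Sum>w \<in> ?V. (c * D w + K) * y w)"
    using row2 y0 by (intro sum_mono mult_right_mono) auto
  also have "\<dots> = c * s1 + K * s0"
    by (simp add: s0_def s1_def sum_distrib_left sum.distrib algebra_simps)
  finally have "(L - c) * s1 \<le> K * s0"
    by (simp add: algebra_simps)
  moreover have "(L - c) * (L * s0) \<le> (L - c) * s1"
    using L0 c by (intro mult_left_mono) (auto simp: L_def)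
  ultimately have "((L - c) * L) * s0 \<le> K * s0"
    by (simp add: mult.assoc)
  moreover have "0 < s0"
    unfolding s0_def using x(1) pair_finite_verts
    by (auto intro!: sum_pos2 simp: y_def)
  ultimately show ?thesis
    by (simp add: L_def)
qed

section \<open>From path covers to coverability and the spectral condition\<close>

lemma set_vwalk_arcs_subset_iff:
  "set (vwalk_arcs p) \<subseteq> E \<longleftrightarrow> successively (\<lambda>a b. (a, b) \<in> E) p"
  by (induction p rule: vwalk_arcs.induct) auto

text \<open>Disjoint paths have different last vertices, so the map sending a path to the index of
  its last vertex is injective on the finite set \<open>I\<close>, hence a permutation.\<close>

lemma path_cover_imp_permutation:
  fixes u v :: "nat \<Rightarrow> 'a"
  assumes "\<exists>P. path_cover (pverts G) (parcs G) I u (v ` I) P" and I: "finite I" and v: "inj_on v I"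
  shows "\<exists>\<tau> P. \<tau> permutes I \<and>
    (\<forall>i \<in> I. vpath (P i) (with_proj G) \<and> hd (P i) = u i \<and> last (P i) = v (\<tau> i)) \<and>
    (\<forall>w \<in> pverts G. \<exists>!i. i \<in> I \<and> w \<in> set (P i))"
proof -
  obtain P where P: "path_cover (pverts G) (parcs G) I u (v ` I) P"
    using assms(1) by blast
  have each: "P i \<noteq> []" "distinct (P i)" "successively (\<lambda>a b. (a, b) \<in> parcs G) (P i)"
      "hd (P i) = u i" "last (P i) \<in> v ` I" if "i \<in> I" for i
    using P that by (auto simp: path_cover_def)
  have disj: "i = j" if "i \<in> I" "j \<in> I" "w \<in> set (P i)" "w \<in> set (P j)" for i j w
    using P that unfolding path_cover_def by blast
  have cov: "(\<Union>i \<in> I. set (P i)) = pverts G"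
    using P by (simp add: path_cover_def)
  \<comment> \<open>\<open>permutes\<close> demands that points outside \<open>I\<close> be
    fixed.\<close>
  define \<tau> where "\<tau> i = (if i \<in> I then the_inv_into I v (last (P i)) else i)" for i
  have last: "last (P i) = v (\<tau> i)" and \<tau>: "\<tau> i \<in> I" if "i \<in> I" for i
    using each(5)[OF that] v that by (auto simp: \<tau>_def f_the_inv_into_f the_inv_into_f_f)
  have "inj_on \<tau> I"
  proof (rule inj_onI)
    fix i j assume ij: "i \<in> I" "j \<in> I" "\<tau> i = \<tau> j"
    then have "last (P i) = last (P j)"
      by (simp add: last)
    then show "i = j"
      using disj[OF ij(1,2), of "last (P i)"] each(1) ij by (metis last_in_set)
  qed
  then have "bij_betw \<tau> I I"
    using I \<tau> by (simp add: bij_betw_def endo_inj_surj image_subset_iff)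
  then have "\<tau> permutes I"
    by (rule bij_imp_permutes) (simp add: \<tau>_def)
  moreover have "vpath (P i) (with_proj G)" if "i \<in> I" for i
    using each(1-3)[OF that] cov that
    by (auto simp: vpath_def vwalk_def set_vwalk_arcs_subset_iff)
  moreover have "\<exists>!i. i \<in> I \<and> w \<in> set (P i)" if "w \<in> pverts G" for w
    using cov disj that by blast
  ultimately show ?thesis
    using each(4) last by (intro exI[of _ \<tau>] exI[of _ P] conjI ballI) simp_all
qed

text \<open>\<open>h0\<close> bounds the number of edges, while \<open>parcs\<close> holds two arcs
  for each edge; hence the factor 2.\<close>

lemma (in pair_graph) many_to_many_disjoint_path_coverable_if_h0_less:
  assumes V: "card (pverts G) = n" and d: "min_degree G = d"
    and t: "0 < t" "t < d"
    and arcs: "2 * h0 n t d < card (parcs G)"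
  shows "many_to_many_disjoint_path_coverable t G"
proof -
  let ?I = "{1..t}"
  have E: "sym (parcs G)" "parcs G \<subseteq> pverts G \<times> pverts G - Id"
    using pair_sym_arcs by (auto simp: symmetric_def dest: in_arcsD1 in_arcsD2 pair_no_loops)
  have "pverts G \<noteq> {}"
    using arcs E(2) by auto
  then have "d \<in> out_degree G ` pverts G"
    unfolding d[symmetric] min_degree_def using pair_finite_verts by (intro Min_in) auto
  then obtain z where z: "z \<in> pverts G" "card (parcs G `` {z}) = d"
    by (auto simp: out_degree_eq_card_neighbours)
  have deg: "d \<le> card (parcs G `` {w})" if "w \<in> pverts G" for w
    unfolding d[symmetric] min_degree_def out_degree_eq_card_neighbours[symmetric]
    using pair_finite_verts that by simp
  have cover: "\<exists>P. path_cover (pverts G) (parcs G) ?I u (v ` ?I) P"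
    if uv: "inj_on u ?I" "inj_on v ?I" "u ` ?I \<subseteq> pverts G" "v ` ?I \<subseteq> pverts G"
      "u ` ?I \<inter> v ` ?I = {}" for u v :: "nat \<Rightarrow> 'a"
  proof (rule ccontr)
    assume "\<not> ?thesis"
    then have none: "\<not> path_cover (pverts G) (parcs G) ?I u (v ` ?I) P" for P
      by blast
    obtain k where k: "d \<le> k" "2 * k < n + t"
      "card (parcs G) \<le> (n + t - k) * (n + t - k - 1) + 2 * ((k - t - 1) * k + d)"
      by (rule not_path_cover_card_arcs[OF pair_finite_verts V E uv(3-5,1,2) _ _ _ t(2) deg z none])
        (use t in auto)
    from k(3) arcs_bound_le_h0[OF t(2) k(1,2)] have "card (parcs G) \<le> 2 * h0 n t d"
      by (rule order_trans)
    with arcs show False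
      by simp
  qed
  show ?thesis
    unfolding many_to_many_disjoint_path_coverable_def
    by (intro allI impI, elim conjE)
      (rule path_cover_imp_permutation[OF cover finite_atLeastAtMost]; assumption)
qed

theorem corollary2p11:
  fixes n t \<delta> :: nat and \<alpha> :: real and G :: "'a pair_pre_digraph"
  assumes "3 \<le> n"
    and "4 \<le> 2 * t" and "2 * t \<le> \<delta>" and "\<delta> \<le> (n + t - 1) div 2"
    and "0 \<le> \<alpha>" and "\<alpha> < 1"
    and "pair_graph G" and "connected G"
    and "card (pverts G) = n" and "min_degree G = \<delta>"
    and "alpha_spectral_radius \<alpha> G >
      ((real \<delta> + \<alpha> * real n - \<alpha> * real \<delta> - 1) +
        sqrt ((real \<delta> + \<alpha> * real n - \<alpha> * real \<delta> - 1)\<^sup>2 +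
          4 * (1 - \<alpha>) * (2 * real (h0 n t \<delta>) - real n * real \<delta> + real \<delta>))) / 2"
  shows "many_to_many_disjoint_path_coverable t G"
proof (rule ccontr)
  assume no: "\<not> many_to_many_disjoint_path_coverable t G"
  interpret pair_graph G
    by fact
  define L where "L = alpha_spectral_radius \<alpha> G"
  define c where "c = real \<delta> + \<alpha> * real n - \<alpha> * real \<delta> - 1"
  \<comment> \<open>\<open>K\<close> belongs to the threshold, \<open>K'\<close> to the actual
    number of arcs; the arc bound for noncoverable graphs compares them.\<close>
  define K where "K = (1 - \<alpha>) * (2 * real (h0 n t \<delta>) - real n * real \<delta> + real \<delta>)"
  define K' where "K' = (1 - \<alpha>) * (real (card (parcs G)) - real n * real \<delta> + real \<delta>)"
  have ne: "pverts G \<noteq> {}"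
    using assms(1,9) by auto
  have deg: "\<delta> \<le> out_degree G w" if "w \<in> pverts G" for w
    unfolding assms(10)[symmetric] min_degree_def using pair_finite_verts that by simp
  have "card (parcs G) \<le> 2 * h0 n t \<delta>"
    using many_to_many_disjoint_path_coverable_if_h0_less[OF assms(9,10)] no assms(2,3)
    by (cases "2 * h0 n t \<delta> < card (parcs G)") simp_all
  then have h0: "real (card (parcs G)) \<le> 2 * real (h0 n t \<delta>)"
    by linarith
  then have "K' \<le> K"
    using assms(6) unfolding K_def K'_def by (intro mult_left_mono) auto
  \<comment> \<open>Nonnegativity of \<open>K\<close> makes the square root at least the absolute
    value of \<open>c\<close>, which places \<open>L\<close> above \<open>c\<close>.\<close>
  have "n * \<delta> \<le> card (parcs G)"
    using sum_bounded_below[of "pverts G" \<delta> "out_degree G"] deg by (simp add: sum_out_degree assms(9))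
  then have "real n * real \<delta> \<le> real (card (parcs G))"
    by (metis of_nat_le_iff of_nat_mult)
  then have "0 \<le> K"
    using h0 assms(6) unfolding K_def by (intro mult_nonneg_nonneg) auto
  have "(c + sqrt (c\<^sup>2 + 4 * K)) / 2 < L"
    using assms(11) unfolding L_def c_def K_def mult.assoc .
  \<comment> \<open>The threshold is the larger root of \<open>z * z - c * z - K\<close>; squaring
    this inequality gives \<open>K < (L - c) * L\<close>.\<close>
  then have L: "sqrt (c\<^sup>2 + 4 * K) < 2 * L - c"
    by (simp add: field_simps)
  have "\<bar>c\<bar> \<le> sqrt (c\<^sup>2 + 4 * K)"
    using \<open>0 \<le> K\<close> by (intro real_le_rsqrt) simp
  then have "c < L"
    using L by linarith
  have "c\<^sup>2 + 4 * K < (2 * L - c)\<^sup>2"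
    using power_strict_mono[OF L, of 2] \<open>0 \<le> K\<close> by simp
  then have "K < (L - c) * L"
    by (simp add: power2_eq_square algebra_simps)
  moreover have "(L - c) * L \<le> K'"
    using alpha_spectral_radius_quadratic[OF ne assms(5,6) deg] \<open>c < L\<close>
    by (simp add: L_def c_def K'_def assms(9))
  ultimately show False
    using \<open>K' \<le> K\<close> by simp
qed

end
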